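(* For all integers $n\ge 0$ and real numbers $p$, the integral $I_{n,p}=\int_{0}^{\infty}\frac{\sin^{2n+1}x}{x}\cos(2px)\,dx$ is equal to $$I_{n,p}=\frac{(-1)^{n}\pi}{2^{2n+1}}\sum_{k=0}^{2n+1}\binom{2n+1}{k}(-1)^{k}\,H\!\left(p+n+\tfrac12-k\right),$$ where $H$ is the Heaviside function defined by $H(x)=1$ for $x\ge 0$ and $H(x)=0$ for $x<0$. Moreover, at integer values of $p$, this evaluation coincides with Ramanujan's formula $$I_{n,p}=(-1)^{p}\,\frac{\sqrt{\pi}}{2}\,\frac{\Gamma(n+1)\,\Gamma\left(n+\frac12\right)}{\Gamma(n-p+1)\,\Gamma(n+p+1)}.$$
   Context: The integral $I_{n,p}$ is understood as a (possibly conditionally convergent) improper Riemann integral. $\Gamma$ is Euler's Gamma function, and $1/\Gamma$ is taken to be $0$ at the poles of $\Gamma$ (the non-positive integers), so the right-hand side of Ramanujan's formula is $0$ when $p$ is an integer with $|p|>n$.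
   Formalization: The Heaviside formula with H(0)=1 is false when p+n+1/2-k=0 for some k in 0..2n+1 (e.g. n=0, p=1/2: integral π/4, right side 0); it is stated for all other real p, and at these p with H(0)=1/2 instead. *)

theory Defs
  imports "HOL-Analysis.Analysis"
begin

(* On the compact intervals {a..b} the gauge integral of the library is used. A bounded
   integrand with at most one discontinuity, as below, is Riemann integrable there, and the
   two integrals agree. *)
definition has_improper_integral :: "(real \<Rightarrow> real) \<Rightarrow> real \<Rightarrow> real \<Rightarrow> bool" where
  "has_improper_integral f a v \<longleftrightarrow>
     (\<forall>b\<ge>a. f integrable_on {a..b}) \<and> ((\<lambda>b. integral {a..b} f) \<longlongrightarrow> v) at_top"

(* The value at x = 0 is 0 because of division by zero; this has no influence on the integral. *)
definition integrand :: "nat \<Rightarrow> real \<Rightarrow> real \<Rightarrow> real" where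
  "integrand n p x = sin x ^ (2 * n + 1) / x * cos (2 * p * x)"

definition heaviside :: "real \<Rightarrow> real" where
  "heaviside x = (if x \<ge> 0 then 1 else 0)"

(* The step function h is a parameter because the convention for its value at 0 matters
   when p + n + 1/2 is one of the integers 0, ..., 2 n + 1. *)
definition step_sum :: "(real \<Rightarrow> real) \<Rightarrow> nat \<Rightarrow> real \<Rightarrow> real" where
  "step_sum h n p = (- 1) ^ n * pi / 2 ^ (2 * n + 1) *
     (\<Sum>k = 0..2 * n + 1. real ((2 * n + 1) choose k) * (- 1) ^ k * h (p + real n + 1 / 2 - real k))"

(* rGamma is the entire function 1 / Gamma, which vanishes at the non-positive integers. *)
definition ramanujan_value :: "nat \<Rightarrow> int \<Rightarrow> real" where
  "ramanujan_value n m = (- 1) powi m * (sqrt pi / 2) *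
     (Gamma (real n + 1) * Gamma (real n + 1 / 2)) *
     (rGamma (real n - real_of_int m + 1) * rGamma (real n + real_of_int m + 1))"

end

theory Submission
  imports Defs "HOL-Probability.Sinc_Integral"
begin

text \<open>
  Put \<open>N = 2 n + 1\<close>. Expanding \<open>(exp (i x) - exp (- i x)) ^ N\<close> by the binomial theorem and
  multiplying by \<open>exp (2 i p x)\<close> before taking imaginary parts gives
  \[ \sin^N x \cos (2 p x) = \frac{(-1)^n}{2^N} \sum_{k \le N} (-1)^k {N \choose k} \sin ((N - 2 k + 2 p) x), \]
  so the integral is a finite combination of Dirichlet integrals
  \<open>\<integral> sin (\<theta> t) / t dt = sgn \<theta> * pi / 2\<close> over the half-line (lemmas
  \<open>sin_odd_power_mult_cos\<close> and \<open>has_improper_integral_Dirichlet\<close>).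
  Here \<open>\<theta> = 2 (p + n + 1/2 - k)\<close>, and \<open>sgn (2 y) = 2 H y - 1\<close> if \<open>H\<close> takes the value \<open>1/2\<close> at \<open>0\<close>.
  The constants \<open>-1\<close> contribute the full alternating row sum of binomial coefficients, which
  vanishes, and what remains is the step sum. Thus the formula always holds with
  \<open>H 0 = 1/2\<close> (lemma \<open>has_improper_integral_half_step_sum\<close>), and with any value of \<open>H 0\<close> as long
  as no argument of \<open>H\<close> is zero.

  For an integer \<open>p\<close> every argument is a half-integer, hence nonzero, and the step function cuts the
  alternating row sum off after \<open>k = n + p\<close>. By Pascal's rule the partial
  alternating sums of row \<open>N\<close> telescope, here to \<open>(-1) ^ (n + p) * (2 n choose (n + p))\<close> if
  \<open>\<bar>p\<bar> \<le> n\<close>; otherwise the sum is empty or runs over the full row, and is \<open>0\<close>. Ramanujan's formula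
  is the same number, because \<open>Gamma (n + 1) * Gamma (n + 1/2) = sqrt pi * (2 n)! / 4 ^ n\<close> and
  \<open>rGamma\<close> vanishes at the non-positive integers.
\<close>

section \<open>Improper integrals\<close>

lemma has_improper_integral_mult:
  assumes "has_improper_integral f a v"
  shows "has_improper_integral (\<lambda>x. c * f x) a (c * v)"
  using assms unfolding has_improper_integral_def
  by (auto intro!: tendsto_intros integrable_on_mult_right)

lemma has_improper_integral_sum:
  assumes "finite I" "\<And>i. i \<in> I \<Longrightarrow> has_improper_integral (f i) a (v i)"
  shows "has_improper_integral (\<lambda>x. \<Sum>i\<in>I. f i x) a (\<Sum>i\<in>I. v i)"
proof -
  have "((\<lambda>b. \<Sum>i\<in>I. integral {a..b} (f i)) \<longlongrightarrow> (\<Sum>i\<in>I. v i)) at_top"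
    using assms(2) unfolding has_improper_integral_def by (intro tendsto_sum) auto
  moreover have "\<forall>\<^sub>F b in at_top. (\<Sum>i\<in>I. integral {a..b} (f i)) = integral {a..b} (\<lambda>x. \<Sum>i\<in>I. f i x)"
    using eventually_ge_at_top[of a]
    by eventually_elim
      (use assms in \<open>simp add: has_improper_integral_def integral_sum\<close>)
  ultimately show ?thesis
    using assms unfolding has_improper_integral_def
    by (auto intro!: integrable_sum intro: Lim_transform_eventually)
qed

text \<open>
  By the chain rule \<open>Si (\<theta> t)\<close> is an antiderivative of \<open>sin (\<theta> t) / t\<close> except at \<open>0\<close>, where the
  quotient is \<open>0\<close> by convention instead of its limit \<open>\<theta>\<close>; hence the version of the fundamental
  theorem that asks for the derivative in the interior only.
\<close>

lemma has_integral_sin_scale_divide: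
  fixes \<theta> b :: real
  assumes "0 \<le> b"
  shows "((\<lambda>t. sin (\<theta> * t) / t) has_integral Si (\<theta> * b)) {0..b}"
proof -
  have "((\<lambda>t. sin (\<theta> * t) / t) has_integral (Si (\<theta> * b) - Si (\<theta> * 0))) {0..b}"
  proof (rule fundamental_theorem_of_calculus_interior[OF assms])
    show "continuous_on {0..b} (\<lambda>t. Si (\<theta> * t))"
      by (intro continuous_at_imp_continuous_on ballI)
        (auto intro!: continuous_intros isCont_o2[OF _ isCont_Si])
    fix t assume t: "t \<in> {0<..<b}"
    have "((\<lambda>t. Si (\<theta> * t)) has_real_derivative sinc (\<theta> * t) * (\<theta> * 1)) (at t)"
      by (rule DERIV_chain2[OF DERIV_Si]) (auto intro!: derivative_eq_intros)
    moreover have "sinc (\<theta> * t) * (\<theta> * 1) = sin (\<theta> * t) / t"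
      using t by auto
    ultimately show "((\<lambda>t. Si (\<theta> * t)) has_vector_derivative sin (\<theta> * t) / t) (at t)"
      by (simp add: has_real_derivative_iff_has_vector_derivative)
  qed
  moreover have "Si 0 = 0"
    using Si_neg[of 0] by simp
  ultimately show ?thesis by simp
qed

text \<open>The sine integral is odd and tends to \<open>pi / 2\<close>, so only the sign of the frequency survives.\<close>

lemma has_improper_integral_Dirichlet:
  fixes \<theta> :: real
  shows "has_improper_integral (\<lambda>t. sin (\<theta> * t) / t) 0 (sgn \<theta> * (pi / 2))"
proof -
  have "((\<lambda>b. Si (\<theta> * b)) \<longlongrightarrow> sgn \<theta> * (pi / 2)) at_top"
  proof -
    have abs: "((\<lambda>b. Si (\<bar>\<theta>\<bar> * b)) \<longlongrightarrow> pi / 2) at_top" if "\<theta> \<noteq> 0"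
      by (rule filterlim_compose[OF Si_at_top])
        (use that in \<open>auto intro!: filterlim_tendsto_pos_mult_at_top[OF tendsto_const] filterlim_ident\<close>)
    have "\<forall>\<^sub>F b in at_top. sgn \<theta> * Si (\<bar>\<theta>\<bar> * b) = Si (\<theta> * b)"
      using eventually_ge_at_top[of 0]
    proof eventually_elim
      case (elim b)
      show ?case
        using Si_neg[of "\<bar>\<theta>\<bar> * b"] Si_neg[of 0] elim
        by (cases \<theta> "0::real" rule: linorder_cases) (auto simp: mult_nonpos_nonneg)
    qed
    moreover have "((\<lambda>b. sgn \<theta> * Si (\<bar>\<theta>\<bar> * b)) \<longlongrightarrow> sgn \<theta> * (pi / 2)) at_top"
      using tendsto_mult[OF tendsto_const abs] by (cases "\<theta> = 0") auto
    ultimately show ?thesis by (rule Lim_transform_eventually[rotated])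
  qed
  moreover have "\<forall>\<^sub>F b in at_top. Si (\<theta> * b) = integral {0..b} (\<lambda>t. sin (\<theta> * t) / t)"
    using eventually_ge_at_top[of 0]
    by eventually_elim (metis has_integral_sin_scale_divide integral_unique)
  ultimately show ?thesis
    unfolding has_improper_integral_def
    using has_integral_sin_scale_divide by (blast intro: Lim_transform_eventually has_integral_integrable)
qed

section \<open>Reduction to Dirichlet integrals\<close>

text \<open>
  This is the imaginary part of \<open>exp (i a) * (exp (i x) - exp (- i x)) ^ N = exp (i a) * (2 i sin x) ^ N\<close>
  with \<open>N = 2 n + 1\<close>. As \<open>i ^ N = (-1) ^ n * i\<close>, it is the real part of the factor \<open>exp (i a)\<close>
  that contributes.
\<close>

lemma sin_odd_power_mult_cos:
  fixes a x :: real
  shows "sin x ^ (2 * n + 1) * cos a = (- 1) ^ n / 2 ^ (2 * n + 1) *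
    (\<Sum>k\<le>2 * n + 1. real ((2 * n + 1) choose k) * (- 1) ^ k * sin ((real (2 * n + 1) - 2 * real k) * x + a))"
proof -
  define N where "N = 2 * n + 1"
  have term_cis: "cis a * (of_nat (N choose k) * (- cis (- x)) ^ k * cis x ^ (N - k))
      = of_real (real (N choose k) * (- 1) ^ k) * cis ((real N - 2 * real k) * x + a)"
    if "k \<le> N" for k
  proof -
    have "a + (real k * (- x) + real (N - k) * x) = (real N - 2 * real k) * x + a"
      using that by (simp add: of_nat_diff algebra_simps)
    then have "cis a * (cis (- x) ^ k * cis x ^ (N - k)) = cis ((real N - 2 * real k) * x + a)"
      unfolding Complex.DeMoivre cis_mult by (simp only:)
    then show ?thesis
      by (simp add: power_minus[of "cis (- x)"] mult_ac)
  qed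
  have "- cis (- x) + cis x = 2 * \<i> * of_real (sin x)"
    by (simp add: complex_eq_iff)
  then have "cis a * (2 * \<i> * of_real (sin x)) ^ N = cis a * (- cis (- x) + cis x) ^ N"
    by simp
  also have "\<dots> = (\<Sum>k\<le>N. of_real (real (N choose k) * (- 1) ^ k) * cis ((real N - 2 * real k) * x + a))"
    unfolding binomial_ring sum_distrib_left by (intro sum.cong refl term_cis) auto
  finally have "Im (cis a * (2 * \<i> * of_real (sin x)) ^ N) =
      (\<Sum>k\<le>N. real (N choose k) * (- 1) ^ k * sin ((real N - 2 * real k) * x + a))"
    by (simp del: of_real_mult of_real_power)
  moreover have "cis a * (2 * \<i> * of_real (sin x)) ^ N
      = of_real (2 ^ N * (- 1) ^ n * sin x ^ N) * (\<i> * cis a)"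
    by (simp add: N_def power_mult_distrib power_mult power_minus[of "4 * z" for z])
  ultimately have "2 ^ N * (- 1) ^ n * sin x ^ N * cos a =
      (\<Sum>k\<le>N. real (N choose k) * (- 1) ^ k * sin ((real N - 2 * real k) * x + a))"
    by (simp del: of_real_mult of_real_power)
  moreover have "sin x ^ N * cos a = (- 1) ^ n / 2 ^ N * (2 ^ N * (- 1) ^ n * sin x ^ N * cos a)"
    by (simp flip: power_add mult_2)
  ultimately show ?thesis
    unfolding N_def by simp
qed

lemma integrand_eq_sum:
  "integrand n p = (\<lambda>x. \<Sum>k = 0..2 * n + 1. (- 1) ^ n / 2 ^ (2 * n + 1) * (real ((2 * n + 1) choose k) * (- 1) ^ k) *
     (sin (2 * (p + real n + 1 / 2 - real k) * x) / x))"
proof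
  fix x
  have arg: "(real (2 * n + 1) - 2 * real k) * x + 2 * p * x = 2 * (p + real n + 1 / 2 - real k) * x" for k
    by (simp add: algebra_simps)
  have "integrand n p x = sin x ^ (2 * n + 1) * cos (2 * p * x) / x"
    by (simp add: integrand_def)
  also have "\<dots> = (\<Sum>k = 0..2 * n + 1. (- 1) ^ n / 2 ^ (2 * n + 1) *
      (real ((2 * n + 1) choose k) * (- 1) ^ k) * (sin (2 * (p + real n + 1 / 2 - real k) * x) / x))"
    unfolding sin_odd_power_mult_cos arg sum_divide_distrib sum_distrib_left atLeast0AtMost
    by (intro sum.cong) simp_all
  finally show "integrand n p x = (\<Sum>k = 0..2 * n + 1. (- 1) ^ n / 2 ^ (2 * n + 1) *
      (real ((2 * n + 1) choose k) * (- 1) ^ k) * (sin (2 * (p + real n + 1 / 2 - real k) * x) / x))" .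
qed

text \<open>
  Writing \<open>sgn y / 2\<close> as \<open>H y - 1/2\<close>, the constant drops out because the binomial coefficients of a
  nonempty row have alternating sum \<open>0\<close>. At \<open>y = 0\<close> this forces the value \<open>H 0 = 1/2\<close>.
\<close>

lemma has_improper_integral_half_step_sum:
  "has_improper_integral (integrand n p) 0 (step_sum (heaviside(0 := 1 / 2)) n p)"
proof -
  define h where "h = heaviside(0 := 1 / 2)"
  define y where "y k = p + real n + 1 / 2 - real k" for k
  define c where "c k = real ((2 * n + 1) choose k) * (- 1) ^ k" for k
  define d :: real where "d = (- 1) ^ n / 2 ^ (2 * n + 1)"
  have "has_improper_integral (integrand n p) 0 (\<Sum>k = 0..2 * n + 1. d * c k * (sgn (2 * y k) * (pi / 2)))"
    unfolding integrand_eq_sum d_def c_def y_def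
    by (intro has_improper_integral_sum has_improper_integral_mult has_improper_integral_Dirichlet) simp
  moreover have "(\<Sum>k = 0..2 * n + 1. d * c k * (sgn (2 * y k) * (pi / 2))) = step_sum h n p"
  proof -
    have sgn_eq: "sgn (2 * y k) * (pi / 2) = pi * (h (y k) - 1 / 2)" for k
      by (auto simp: h_def heaviside_def sgn_real_def field_simps)
    have "d * c k * (sgn (2 * y k) * (pi / 2)) = d * pi * (c k * h (y k)) - d * pi / 2 * c k" for k
      unfolding sgn_eq by (simp add: algebra_simps)
    then have "(\<Sum>k = 0..2 * n + 1. d * c k * (sgn (2 * y k) * (pi / 2)))
        = d * pi * (\<Sum>k = 0..2 * n + 1. c k * h (y k)) - d * pi / 2 * (\<Sum>k = 0..2 * n + 1. c k)"
      by (simp only: sum_distrib_left sum_subtractf)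
    moreover have "(\<Sum>k = 0..2 * n + 1. c k) = 0"
      using choose_alternating_sum[of "2 * n + 1", where ?'a = real]
      by (simp add: c_def atLeast0AtMost mult.commute)
    ultimately show ?thesis
      by (simp add: step_sum_def c_def d_def y_def)
  qed
  ultimately show ?thesis by (simp add: h_def)
qed

lemma step_sum_fun_upd_zero:
  assumes "\<forall>k\<in>{0..2 * n + 1}. p + real n + 1 / 2 - real k \<noteq> 0"
  shows "step_sum (h(0 := v)) n p = step_sum h n p"
  using assms unfolding step_sum_def by (intro arg_cong2[where f = "(*)"] sum.cong) auto

section \<open>Integer values of the parameter\<close>

text \<open>The step function truncates the alternating sum of a binomial row, and the truncated sum is a
  binomial coefficient of the row above.\<close>

lemma step_sum_int:
  "step_sum heaviside n (real_of_int m) =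
     (if \<bar>m\<bar> \<le> int n then (- 1) powi m * pi / 2 ^ (2 * n + 1) * real ((2 * n) choose nat (int n + m)) else 0)"
proof -
  have H: "heaviside (real_of_int m + real n + 1 / 2 - real k) = (if int k \<le> int n + m then 1 else 0)" for k
  proof -
    have "real_of_int m + real n + 1 / 2 - real k \<ge> 0 \<longleftrightarrow> int k \<le> int n + m"
      by linarith
    then show ?thesis by (simp add: heaviside_def)
  qed
  have cut: "(\<Sum>k = 0..2 * n + 1. real ((2 * n + 1) choose k) * (- 1) ^ k *
        heaviside (real_of_int m + real n + 1 / 2 - real k))
      = (\<Sum>k | k \<in> {0..2 * n + 1} \<and> int k \<le> int n + m. real ((2 * n + 1) choose k) * (- 1) ^ k)"
    unfolding H sum.inter_filter[OF finite_atLeastAtMost] by (intro sum.cong) auto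
  consider "m < - int n" | "\<bar>m\<bar> \<le> int n" | "m > int n" by linarith
  then show ?thesis
  proof cases
    case 1
    then have "{k. k \<in> {0..2 * n + 1} \<and> int k \<le> int n + m} = {}" by auto
    with 1 show ?thesis unfolding step_sum_def cut by simp
  next
    case 2
    \<comment> \<open>The last index that the step function keeps.\<close>
    define j where "j = nat (int n + m)"
    have m: "m = int j - int n" using 2 by (simp add: j_def)
    have "{k. k \<in> {0..2 * n + 1} \<and> int k \<le> int n + m} = {..j}" using 2 by (auto simp: m)
    then have "(\<Sum>k | k \<in> {0..2 * n + 1} \<and> int k \<le> int n + m. real ((2 * n + 1) choose k) * (- 1) ^ k)
        = (- 1) ^ j * real ((2 * n) choose j)"
      using gbinomial_sum_lower_neg[of "real (2 * n + 1)" j]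
      by (simp add: binomial_gbinomial)
    moreover have "(- 1) ^ n * (- 1) ^ j = ((- 1) powi m :: real)"
      by (simp add: m power_int_diff power_int_minus_one_mult_self field_simps flip: power_int_of_nat)
    ultimately show ?thesis
      using 2 unfolding step_sum_def cut j_def[symmetric] by (simp add: mult_ac)
  next
    case 3
    then have "{k. k \<in> {0..2 * n + 1} \<and> int k \<le> int n + m} = {..2 * n + 1}" by auto
    moreover have "(\<Sum>k\<le>2 * n + 1. real ((2 * n + 1) choose k) * (- 1) ^ k) = 0"
      using choose_alternating_sum[of "2 * n + 1", where ?'a = real]
      by (simp only: mult.commute)
    ultimately show ?thesis
      using 3 unfolding step_sum_def cut by (simp only:) simp
  qed
qed

lemma Gamma_nat_plus_half:
  "Gamma (real n + 1 / 2) = sqrt pi * fact (2 * n) / (4 ^ n * fact n)"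
proof (induction n)
  case 0
  show ?case by (simp add: Gamma_one_half_real)
next
  case (Suc n)
  have "Gamma (real (Suc n) + 1 / 2) = Gamma (real n + 1 / 2 + 1)"
    by (simp add: add_ac)
  also have "\<dots> = (real n + 1 / 2) * Gamma (real n + 1 / 2)"
    by (rule Gamma_plus1) (auto elim!: nonpos_Ints_cases)
  also have "\<dots> = sqrt pi * fact (2 * Suc n) / (4 ^ Suc n * fact (Suc n))"
    unfolding Suc by (simp add: divide_simps) (simp add: algebra_simps)
  finally show ?case .
qed

text \<open>
  If \<open>\<bar>m\<bar> \<le> n\<close>, the two reciprocal Gamma values are \<open>1 / (n - m)!\<close> and \<open>1 / (n + m)!\<close>, which turn
  \<open>(2 n)!\<close> into a binomial coefficient. Otherwise one of their arguments is a pole of \<open>Gamma\<close>.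
\<close>

lemma ramanujan_value_eq:
  "ramanujan_value n m =
     (if \<bar>m\<bar> \<le> int n then (- 1) powi m * pi / 2 ^ (2 * n + 1) * real ((2 * n) choose nat (int n + m)) else 0)"
proof (cases "\<bar>m\<bar> \<le> int n")
  case True
  define i j where "i = nat (int n - m)" and "j = nat (int n + m)"
  have ij: "real n - real_of_int m = real i" "real n + real_of_int m = real j" "i + j = 2 * n"
    using True by (auto simp: i_def j_def)
  have rG: "rGamma (real l + 1) = 1 / fact l" for l
    using Gamma_fact[of l, where ?'a = real] by (simp add: rGamma_inverse_Gamma add_ac divide_simps)
  have "real ((2 * n) choose j) = fact (2 * n) / (fact i * fact j)"
    using binomial_fact[of j "2 * n", where ?'a = real] ij(3)
    by (metis add_diff_cancel_right' le_add2 mult.commute)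
  moreover have "Gamma (real n + 1) = fact n"
    using Gamma_fact[of n, where ?'a = real] by (simp add: add_ac)
  moreover have "sqrt pi * (sqrt pi * z) = pi * z" for z
    by (simp flip: mult.assoc)
  moreover have "(2::real) ^ (2 * n + 1) = 2 * 4 ^ n"
    by (simp add: power_mult)
  ultimately show ?thesis
    using True
    by (simp add: ramanujan_value_def Gamma_nat_plus_half ij rG flip: j_def)
next
  case False
  have "rGamma (real n - real_of_int m + 1) = 0 \<or> rGamma (real n + real_of_int m + 1) = 0"
  proof (cases "m > 0")
    case True
    with False have "real n - real_of_int m + 1 = of_int (int n - m + 1)" "int n - m + 1 \<le> 0"
      by auto
    then show ?thesis
      unfolding rGamma_eq_zero_iff by (metis nonpos_Ints_of_int)
  next
    assume "\<not> m > 0"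
    with False have "real n + real_of_int m + 1 = of_int (int n + m + 1)" "int n + m + 1 \<le> 0"
      by auto
    then show ?thesis
      unfolding rGamma_eq_zero_iff by (metis nonpos_Ints_of_int)
  qed
  with False show ?thesis by (auto simp: ramanujan_value_def)
qed

section \<open>Evaluation of the integral\<close>

theorem proposition3:
  fixes n :: nat and p :: real
  shows "((\<forall>k\<in>{0..2 * n + 1}. p + real n + 1 / 2 - real k \<noteq> 0) \<longrightarrow>
            has_improper_integral (integrand n p) 0 (step_sum heaviside n p)) \<and>
         ((\<exists>k\<in>{0..2 * n + 1}. p + real n + 1 / 2 - real k = 0) \<longrightarrow>
            has_improper_integral (integrand n p) 0 (step_sum (heaviside(0 := 1 / 2)) n p)) \<and>
         (\<forall>m::int. p = real_of_int m \<longrightarrow>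
            step_sum heaviside n p = ramanujan_value n m \<and>
            has_improper_integral (integrand n p) 0 (ramanujan_value n m))"
proof -
  have generic: "has_improper_integral (integrand n p) 0 (step_sum heaviside n p)"
    if "\<forall>k\<in>{0..2 * n + 1}. p + real n + 1 / 2 - real k \<noteq> 0"
    using has_improper_integral_half_step_sum[of n p] step_sum_fun_upd_zero[OF that] by simp
  moreover have "p + real n + 1 / 2 - real k \<noteq> 0" if "p = real_of_int m" for m k
  proof
    \<comment> \<open>Doubling would make an even integer equal to an odd one.\<close>
    assume "p + real n + 1 / 2 - real k = 0"
    then have "real_of_int (2 * (m + int n - int k)) = real_of_int (- 1)"
      using that by simp
    then have "2 * (m + int n - int k) = - 1"
      by (simp only: of_int_eq_iff)
    then show False by presburger
  qed
  moreover have "step_sum heaviside n p = ramanujan_value n m" if "p = real_of_int m" for m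
    by (simp add: that step_sum_int ramanujan_value_eq)
  ultimately show ?thesis
    using has_improper_integral_half_step_sum[of n p] by metis
qed

end
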